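(* Let $\mathcal{H}=\mathbb{C}^2$, let $0\le r\le 1$, and let $\mathcal{T}_1=(\xi\otimes\rho_{in},\{I_{anc}\otimes E_m\}_{m\in\Omega_E})$ and $\mathcal{T}_2=(\xi'\otimes\tau_{in},\{I_{anc}\otimes F_n\}_{n\in\Omega_F})$ be two ancilla-free channel measurements, where $\rho_{in},\tau_{in}$ are density operators on $\mathcal{H}$ and $\{E_m\}_{m\in\Omega_E}$, $\{F_n\}_{n\in\Omega_F}$ are POVMs on $\mathcal{H}$. For a random unitary channel $\Lambda$ on $\mathcal{H}$, let $p_m(\Lambda)$ and $q_n(\Lambda)$ be the outcome probabilities of $\mathcal{T}_1$ and $\mathcal{T}_2$, respectively. Let $\mathcal{M}\subset\Omega_E$ and $\mathcal{N}\subset\Omega_F$ be arbitrary subsets and put $$C(\mathcal{M},\mathcal{N}):=\max_{\Lambda}\Big(r\sum_{m\in\mathcal{M}}p_m(\Lambda)+(1-r)\sum_{n\in\mathcal{N}}q_n(\Lambda)\Big),$$ the maximum being over all random unitary channels $\Lambda$ on $\mathcal{H}$. Then for every random unitary channel $\Lambda$ on $\mathcal{H}$, $$r\sum_{m\in\mathcal{M}}p_m(\Lambda)+(1-r)\sum_{n\in\mathcal{N}}q_n(\Lambda)\le C(\mathcal{M},\mathcal{N}),$$ and $$C(\mathcal{M},\mathcal{N})=\frac{Z(\mathcal{M},\mathcal{N})}{2}+\frac12\sqrt{(a-b)^2+4ab\Big(|\langle\psi|\phi\rangle||\langle\psi'|\phi'\rangle|+\sqrt{(1-|\langle\psi|\phi\rangle|^2)(1-|\langle\psi'|\phi'\rangle|^2)}\Big)^2},$$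 where $E(\mathcal{M}):=\sum_{m\in\mathcal{M}}E_m$, $F(\mathcal{N}):=\sum_{n\in\mathcal{N}}F_n$, $Z(\mathcal{M},\mathcal{N}):=\operatorname{tr}[rE(\mathcal{M})+(1-r)F(\mathcal{N})]$, $a:=r\,\Delta\rho_{in}\,\Delta E(\mathcal{M})$, $b:=(1-r)\,\Delta\tau_{in}\,\Delta F(\mathcal{N})$, and $|\psi\rangle,|\phi\rangle,|\psi'\rangle,|\phi'\rangle$ are unit eigenvectors for the maximum eigenvalue of $\rho_{in},\tau_{in},E(\mathcal{M}),F(\mathcal{N})$, respectively.
   Context: A density operator is a linear operator $\rho\ge 0$ with $\operatorname{tr}\rho=1$. A POVM with (finite or countable) outcome set $\Omega$ is a family $\{E_m\}_{m\in\Omega}$ of operators with $0\le E_m\le I$ and $\sum_{m\in\Omega}E_m=I$. A random unitary channel on $\mathcal{H}=\mathbb{C}^2$ is a map $\Lambda(\rho)=\sum_x p_xU_x\rho U_x^\dagger$, where $\{p_x\}_x$ is a probability distribution and each $U_x$ is a unitary operator on $\mathcal{H}$. An ancilla-free channel measurement $(\xi\otimes\rho_{in},\{I_{anc}\otimes E_m\}_{m\in\Omega_E})$ consists of a density operator $\xi$ on an ancilla Hilbert space $\mathcal{H}_{anc}$, a density operator $\rho_{in}$ on $\mathcal{H}$, and a POVM $\{E_m\}_{m\in\Omega_E}$ on $\mathcal{H}$. One prepares $\xi\otimes\rho_{in}$, applies $\Lambda$ to $\mathcal{H}$, and measures $\{I_{anc}\otimes E_m\}$. The probability of outcome $m$ is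 $p_m(\Lambda)=\operatorname{tr}[(I_{anc}\otimes E_m)(\mathrm{id}\otimes\Lambda)(\xi\otimes\rho_{in})]=\operatorname{tr}[E_m\Lambda(\rho_{in})]$. Likewise, for $(\xi'\otimes\tau_{in},\{I_{anc}\otimes F_n\}_{n\in\Omega_F})$, $q_n(\Lambda)=\operatorname{tr}[F_n\Lambda(\tau_{in})]$. For a Hermitian operator $X$ on $\mathbb{C}^2$, $\Delta X$ denotes the difference between the maximum and minimum eigenvalues of $X$. *)

theory Defs
  imports "HOL-Analysis.Analysis"
begin

text \<open>
  Operators on the Hilbert space of dimension 2 are matrices of type complex^2^2.
  The inner product is conjugate-linear in its first argument (bra-ket convention).
\<close>

definition braket :: "complex^'n \<Rightarrow> complex^'n \<Rightarrow> complex" where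
  "braket v w = (\<Sum>i\<in>UNIV. cnj (v $ i) * w $ i)"

definition dagger :: "complex^'n^'m \<Rightarrow> complex^'m^'n" where
  "dagger A = (\<chi> i j. cnj (A $ j $ i))"

definition unitary_op :: "complex^'n^'n \<Rightarrow> bool" where
  "unitary_op U \<longleftrightarrow> dagger U ** U = mat 1 \<and> U ** dagger U = mat 1"

text \<open>Hermiticity is implied, since every value of the quadratic form is required to be real.\<close>

definition positive_op :: "complex^'n^'n \<Rightarrow> bool" where
  "positive_op A \<longleftrightarrow> (\<forall>v. braket v (A *v v) \<in> \<real> \<and> 0 \<le> Re (braket v (A *v v)))"

definition density_op :: "complex^'n^'n \<Rightarrow> bool" where
  "density_op \<rho> \<longleftrightarrow> positive_op \<rho> \<and> trace \<rho> = 1"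

definition povm :: "'m set \<Rightarrow> ('m \<Rightarrow> complex^'n^'n) \<Rightarrow> bool" where
  "povm \<Omega> E \<longleftrightarrow> countable \<Omega>
     \<and> (\<forall>m\<in>\<Omega>. positive_op (E m) \<and> positive_op (mat 1 - E m))
     \<and> (E has_sum mat 1) \<Omega>"

text \<open>
  The unitaries are mixed according to a probability distribution on a countable index set,
  here the natural numbers; finite mixtures are those with finitely many nonzero weights.
\<close>

definition random_unitary_channel :: "(complex^'n^'n \<Rightarrow> complex^'n^'n) \<Rightarrow> bool" where
  "random_unitary_channel \<Lambda> \<longleftrightarrow>
     (\<exists>(p :: nat \<Rightarrow> real) (U :: nat \<Rightarrow> complex^'n^'n).
        (\<forall>x. 0 \<le> p x) \<and> (p has_sum 1) UNIV \<and> (\<forall>x. unitary_op (U x)) \<and>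
        (\<forall>\<rho>. ((\<lambda>x. p x *\<^sub>R (U x ** \<rho> ** dagger (U x))) has_sum \<Lambda> \<rho>) UNIV))"

definition eigenpair :: "complex^'n^'n \<Rightarrow> complex \<Rightarrow> complex^'n \<Rightarrow> bool" where
  "eigenpair A c v \<longleftrightarrow> v \<noteq> 0 \<and> A *v v = c *s v"

text \<open>The next definitions are meant for Hermitian matrices, all of whose eigenvalues are real.\<close>

definition eigenvalues :: "complex^'n^'n \<Rightarrow> real set" where
  "eigenvalues A = {x. \<exists>v. eigenpair A (of_real x) v}"

definition spread :: "complex^'n^'n \<Rightarrow> real" where
  "spread A = Max (eigenvalues A) - Min (eigenvalues A)"

definition unit_top_eigenvector :: "complex^'n^'n \<Rightarrow> complex^'n \<Rightarrow> bool" where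
  "unit_top_eigenvector A v \<longleftrightarrow> norm v = 1 \<and> eigenpair A (of_real (Max (eigenvalues A))) v"

text \<open>
  The ancilla is an arbitrary Hilbert space, of any dimension. After the choice of an orthonormal
  basis indexed by a type 'k it is the space of square-summable families over 'k, and operators
  are given by their (possibly infinite) matrices, of type ('k, complex) kernel.
  A positive semidefinite matrix whose diagonal sums to 1 is exactly the matrix of a positive
  trace-class operator of trace 1; positivity may be tested on finitely supported vectors, which
  are dense. The tensor product with the space of dimension CARD('n) has basis 'k \<times> 'n.
\<close>

type_synonym ('k, 'a) kernel = "'k \<Rightarrow> 'k \<Rightarrow> 'a"

definition kernel_positive :: "('k, complex) kernel \<Rightarrow> bool" where
  "kernel_positive K \<longleftrightarrow> (\<forall>S v. finite S \<longrightarrow>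
     (\<Sum>i\<in>S. \<Sum>j\<in>S. cnj (v i) * K i j * v j) \<in> \<real> \<and>
     0 \<le> Re (\<Sum>i\<in>S. \<Sum>j\<in>S. cnj (v i) * K i j * v j))"

definition kernel_density :: "('k, complex) kernel \<Rightarrow> bool" where
  "kernel_density K \<longleftrightarrow> kernel_positive K \<and> ((\<lambda>i. K i i) has_sum 1) UNIV"

definition kernel_id :: "('k, complex) kernel" where
  "kernel_id i j = (if i = j then 1 else 0)"

definition kernel_mult :: "('k, complex) kernel \<Rightarrow> ('k, complex) kernel \<Rightarrow> ('k, complex) kernel" where
  "kernel_mult A B i j = (\<Sum>\<^sub>\<infinity>k. A i k * B k j)"

definition kernel_trace :: "('k, complex) kernel \<Rightarrow> complex" where
  "kernel_trace A = (\<Sum>\<^sub>\<infinity>i. A i i)"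

definition tensor_op :: "('k, complex) kernel \<Rightarrow> complex^'n^'n \<Rightarrow> ('k \<times> 'n, complex) kernel" where
  "tensor_op K A x y = K (fst x) (fst y) * A $ snd x $ snd y"

text \<open>The map id \<otimes> \<Lambda> applies \<Lambda> to each block with fixed ancilla indices.\<close>

definition id_tensor ::
  "(complex^'n^'n \<Rightarrow> complex^'n^'n) \<Rightarrow> ('k \<times> 'n, complex) kernel \<Rightarrow> ('k \<times> 'n, complex) kernel" where
  "id_tensor \<Lambda> X x y = \<Lambda> (\<chi> c d. X (fst x, c) (fst y, d)) $ snd x $ snd y"

text \<open>
  Probability of the outcome with effect \<open>E\<close>: prepare \<open>\<xi> \<otimes> \<rho>\<close>, apply \<open>id \<otimes> \<Lambda>\<close>, measure \<open>I \<otimes> E\<close>.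
\<close>

definition outcome_prob ::
  "('k, complex) kernel \<Rightarrow> complex^'n^'n \<Rightarrow> complex^'n^'n \<Rightarrow> (complex^'n^'n \<Rightarrow> complex^'n^'n) \<Rightarrow> real" where
  "outcome_prob \<xi> \<rho> E \<Lambda> =
     Re (kernel_trace (kernel_mult (tensor_op kernel_id E) (id_tensor \<Lambda> (tensor_op \<xi> \<rho>))))"

end

theory Submission
  imports Defs
begin

text \<open>
  Since \<open>\<rho> = \<beta> I + \<Delta>\<rho> |\<psi>\<rangle>\<langle>\<psi>|\<close> and \<open>E(\<M>) = \<alpha> I + \<Delta>E |\<psi>'\<rangle>\<langle>\<psi>'|\<close>, and likewise for the second
  measurement, a single unitary \<open>U\<close> gives the value
  \<open>Z/2 + (a cos 2s + b cos 2t)/2\<close> with the Fubini-Study angles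
  \<open>s = \<angle>(\<psi>', U\<psi>)\<close> and \<open>t = \<angle>(\<phi>', U\<phi>)\<close>.
  As \<open>U\<close> is an isometry, the triangle inequality forces
  \<open>s + t \<ge> |\<angle>(\<psi>, \<phi>) - \<angle>(\<psi>', \<phi>')|\<close>, and under this constraint the maximum is the length of the
  planar vector \<open>a + b exp(2i(\<angle>(\<psi>, \<phi>) - \<angle>(\<psi>', \<phi>')))\<close>. It is attained by a \<open>U\<close> that
  carries the real plane spanned by \<open>\<psi>\<close> and (a phase times) \<open>\<phi>\<close> to that of \<open>\<psi>'\<close> and \<open>\<phi>'\<close>.
  Mixing unitaries does not help, because the value is affine in the channel, and the ancilla
  factors out with trace 1.
\<close>

section \<open>Brakets and the Fubini-Study angle\<close>

lemma braket_add_right: "braket u (v + w) = braket u v + braket u w"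
  by (simp add: braket_def algebra_simps sum.distrib)

lemma braket_diff_right: "braket u (v - w) = braket u v - braket u w"
  by (simp add: braket_def algebra_simps sum_subtractf)

lemma braket_scale_right: "braket u (c *s v) = c * braket u v"
  by (simp add: braket_def sum_distrib_left mult_ac)

lemma cnj_braket: "cnj (braket u v) = braket v u"
  by (simp add: braket_def mult.commute)

lemma braket_add_left: "braket (u + v) w = braket u w + braket v w"
  by (simp add: braket_def algebra_simps sum.distrib)

lemma braket_diff_left: "braket (u - v) w = braket u w - braket v w"
  by (simp add: braket_def algebra_simps sum_subtractf)

lemma braket_scale_left: "braket (c *s u) v = cnj c * braket u v"
  by (simp add: braket_def sum_distrib_left mult_ac)

lemma cmod_braket_commute: "cmod (braket u v) = cmod (braket v u)"
  by (metis cnj_braket complex_mod_cnj)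

lemma Re_braket: "Re (braket u v) = u \<bullet> v"
  by (simp add: braket_def inner_vec_def inner_complex_def)

lemma braket_self: "braket v v = of_real ((norm v)\<^sup>2)"
proof (rule complex_eqI)
  show "Re (braket v v) = Re (of_real ((norm v)\<^sup>2))"
    by (simp add: Re_braket power2_norm_eq_inner)
  show "Im (braket v v) = Im (of_real ((norm v)\<^sup>2))"
    using cnj_braket[of v v] by (simp add: complex_eq_iff)
qed

lemma norm_scale_vec: "norm (c *s v) = cmod c * norm v" for v :: "complex^'n"
proof -
  have "of_real ((norm (c *s v))\<^sup>2) = (of_real ((cmod c * norm v)\<^sup>2) :: complex)"
    unfolding braket_self[symmetric] braket_scale_left braket_scale_right
    by (simp add: braket_self power_mult_distrib flip: complex_norm_square mult.assoc)
  then have "(norm (c *s v))\<^sup>2 = (cmod c * norm v)\<^sup>2"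
    using of_real_eq_iff by blast
  then show ?thesis by simp
qed

text \<open>Used to absorb a phase into a vector, so that a complex overlap becomes its
  modulus.\<close>

lemma phase_exists: "\<exists>w. cmod w = 1 \<and> w * z = of_real (cmod z)"
proof (cases "z = 0")
  case True
  then show ?thesis by (intro exI[of _ 1]) simp
next
  case False
  then show ?thesis
    by (intro exI[of _ "cnj z / cmod z"])
      (simp add: norm_divide complex_norm_square[symmetric] power2_eq_square mult.commute)
qed

text \<open>The inner product \<open>\<bullet>\<close> sees only the real part of the braket.
  Turning \<open>v\<close> by a phase that makes the braket real and nonnegative reduces the claim
  to real Cauchy-Schwarz.\<close>

lemma cmod_braket_le: "cmod (braket u v) \<le> norm u * norm v"
proof -
  obtain c where c: "cmod c = 1" "c * braket u v = of_real (cmod (braket u v))"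
    using phase_exists by blast
  have "cmod (braket u v) = u \<bullet> (c *s v)"
    using c by (simp flip: Re_braket add: braket_scale_right)
  also have "\<dots> \<le> norm u * norm (c *s v)" by (rule norm_cauchy_schwarz)
  finally show ?thesis using c by (simp add: norm_scale_vec)
qed

lemma norm_orthogonal_part:
  assumes "norm u = 1" "norm v = 1"
  shows "norm (u - braket v u *s v) = sqrt (1 - (cmod (braket v u))\<^sup>2)"
proof -
  have "of_real ((norm (u - braket v u *s v))\<^sup>2) = (of_real (1 - (cmod (braket v u))\<^sup>2) :: complex)"
  proof -
    have "braket u u = 1" "braket v v = 1" using assms by (simp_all add: braket_self)
    then have "braket (u - braket v u *s v) (u - braket v u *s v) = 1 - braket v u * cnj (braket v u)"
      by (simp add: braket_diff_left braket_diff_right braket_scale_left braket_scale_right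
          cnj_braket algebra_simps)
    then show ?thesis unfolding braket_self complex_norm_square[symmetric] by simp
  qed
  then have "(norm (u - braket v u *s v))\<^sup>2 = 1 - (cmod (braket v u))\<^sup>2"
    using of_real_eq_iff by blast
  then show ?thesis by (metis norm_ge_zero real_sqrt_abs abs_of_nonneg)
qed

definition fubini_study :: "complex^'n \<Rightarrow> complex^'n \<Rightarrow> real" where
  "fubini_study u v = arccos (cmod (braket u v))"

lemma
  assumes "norm u = 1" "norm v = 1"
  shows cos_fubini_study: "cos (fubini_study u v) = cmod (braket u v)"
    and sin_fubini_study: "sin (fubini_study u v) = sqrt (1 - (cmod (braket u v))\<^sup>2)"
    and fubini_study_nonneg: "0 \<le> fubini_study u v"
    and fubini_study_le: "fubini_study u v \<le> pi / 2"
proof -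
  have *: "cmod (braket u v) \<le> 1" using cmod_braket_le[of u v] assms by simp
  have **: "-1 \<le> cmod (braket u v)" using norm_ge_zero[of "braket u v"] by linarith
  show "cos (fubini_study u v) = cmod (braket u v)"
    unfolding fubini_study_def using * ** by (simp add: cos_arccos)
  show "sin (fubini_study u v) = sqrt (1 - (cmod (braket u v))\<^sup>2)"
    unfolding fubini_study_def using * ** by (simp add: sin_arccos)
  show "0 \<le> fubini_study u v" unfolding fubini_study_def using * ** by (simp add: arccos_lbound)
  show "fubini_study u v \<le> pi / 2" unfolding fubini_study_def using * by (intro arccos_le_pi2) auto
qed

lemma fubini_study_commute: "fubini_study u v = fubini_study v u"
  by (simp add: fubini_study_def cmod_braket_commute[of u v])

text \<open>Split \<open>u\<close> and \<open>w\<close> along \<open>v\<close>. The parallel parts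
  contribute a product of cosines to the overlap, and by Cauchy-Schwarz the orthogonal parts
  contribute at most the product of sines. The addition formula then compares the cosines of the two
  sides.\<close>

lemma fubini_study_triangle:
  assumes u: "norm u = 1" and v: "norm v = 1" and w: "norm w = 1"
  shows "fubini_study u w \<le> fubini_study u v + fubini_study v w"
proof -
  define u' where "u' = u - braket v u *s v"
  define w' where "w' = w - braket v w *s v"
  have split: "braket u w = braket u v * braket v w + braket u' w'"
    by (simp add: u'_def w'_def braket_diff_left braket_diff_right braket_scale_left
        braket_scale_right braket_self v cnj_braket algebra_simps)
  have "cmod (braket u' w') \<le> norm u' * norm w'" by (rule cmod_braket_le)
  also have "\<dots> = sin (fubini_study u v) * sin (fubini_study v w)"
    using assms by (simp add: u'_def w'_def norm_orthogonal_part sin_fubini_study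
        cmod_braket_commute[of u v])
  finally have le: "cmod (braket u' w') \<le> sin (fubini_study u v) * sin (fubini_study v w)" .
  have "cmod (braket u v * braket v w) \<le> cmod (braket u w) + cmod (braket u' w')"
    unfolding split by (metis norm_triangle_ineq4 add_diff_cancel_right')
  then have "cos (fubini_study u v + fubini_study v w) \<le> cos (fubini_study u w)"
    using le assms by (simp add: cos_add cos_fubini_study norm_mult)
  \<comment> \<open>The cosine is decreasing on \<open>[0, pi]\<close>, which contains the sum
    because each angle is at most \<open>pi / 2\<close>.\<close>
  then show ?thesis
    using fubini_study_nonneg[OF u v] fubini_study_nonneg[OF v w] fubini_study_nonneg[OF u w]
      fubini_study_le[OF u v] fubini_study_le[OF v w] fubini_study_le[OF u w]
    by (subst (asm) cos_mono_le_eq) auto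
qed

text \<open>Both radicands equal \<open>a^2 + b^2 + 2 a b cos (2 d)\<close>. The planar vector on
  the right can be rotated and projected, which the square root cannot.\<close>

lemma sqrt_law_of_cosines:
  "sqrt ((a - b)\<^sup>2 + 4 * a * b * (cos d)\<^sup>2) = cmod (of_real a + of_real b * cis (2 * d))" for a b d :: real
proof -
  have "(a - b)\<^sup>2 + 4 * a * b * (cos d)\<^sup>2
      = (a + b * cos (2 * d))\<^sup>2 + (b * sin (2 * d))\<^sup>2"
  proof -
    have "(b * sin (2 * d))\<^sup>2 = b\<^sup>2 * (1 - (cos (2 * d))\<^sup>2)"
      by (simp add: power_mult_distrib sin_squared_eq)
    moreover have "(cos d)\<^sup>2 = (1 + cos (2 * d)) / 2"
      by (simp add: cos_double_cos)
    ultimately show ?thesis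
      by (simp only:) (simp add: power2_eq_square algebra_simps)
  qed
  then show ?thesis by (simp add: cmod_def)
qed

text \<open>Shrinking \<open>s\<close> or \<open>t\<close> only increases the left side, so the
  worst case is \<open>s + t = d\<close>. There the left side is the projection of the planar vector
  \<open>a + b cis (2 d)\<close> onto a direction, hence at most its length.\<close>

lemma cosine_combination_le:
  assumes "0 \<le> a" "0 \<le> b" "0 \<le> d" "d \<le> pi / 2" "d \<le> s + t"
    "0 \<le> s" "s \<le> pi / 2" "0 \<le> t" "t \<le> pi / 2"
  shows "a * cos (2 * s) + b * cos (2 * t) \<le> cmod (of_real a + of_real b * cis (2 * d))"
proof -
  have *: "a * cos (2 * x) + b * cos (2 * d - 2 * x) \<le> cmod (of_real a + of_real b * cis (2 * d))" for x
  proof -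
    have "a * cos (2 * x) + b * cos (2 * d - 2 * x) = Re (cis (- 2 * x) * (of_real a + of_real b * cis (2 * d)))"
      by (simp add: cos_diff algebra_simps)
    also have "\<dots> \<le> cmod (cis (- 2 * x) * (of_real a + of_real b * cis (2 * d)))"
      by (rule complex_Re_le_cmod)
    finally show ?thesis by (simp add: norm_mult)
  qed
  show ?thesis
  proof (cases "s \<le> d")
    case True
    have "cos (2 * t) \<le> cos (2 * d - 2 * s)"
      using assms True by (intro cos_monotone_0_pi_le) auto
    then have "b * cos (2 * t) \<le> b * cos (2 * d - 2 * s)" using assms by (intro mult_left_mono)
    then show ?thesis using *[of s] by linarith
  \<comment> \<open>If \<open>s\<close> alone exceeds \<open>d\<close>, compare with the boundary
    point where \<open>s\<close> is \<open>d\<close> and \<open>t\<close> is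
    \<open>0\<close>.\<close>
  next
    case False
    have "cos (2 * s) \<le> cos (2 * d)"
      using assms False by (intro cos_monotone_0_pi_le) auto
    then have "a * cos (2 * s) + b * cos (2 * t) \<le> a * cos (2 * d) + b * 1"
      using assms by (intro add_mono mult_left_mono) auto
    then show ?thesis using *[of d] by simp
  qed
qed

section \<open>Unitaries as isometries of the Fubini-Study angle\<close>

lemma dagger_mult: "dagger (A ** B) = dagger B ** dagger A"
  by (simp add: dagger_def matrix_matrix_mult_def vec_eq_iff mult.commute)

lemma braket_dagger: "braket (A *v u) v = braket u (dagger A *v v)" for A :: "complex^'n^'m"
proof -
  have "braket (A *v u) v = (\<Sum>i\<in>UNIV. \<Sum>j\<in>UNIV. cnj (A$i$j) * cnj (u$j) * v$i)"
    by (simp add: braket_def matrix_vector_mult_def sum_distrib_right)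
  also have "\<dots> = (\<Sum>j\<in>UNIV. \<Sum>i\<in>UNIV. cnj (A$i$j) * cnj (u$j) * v$i)" by (rule sum.swap)
  also have "\<dots> = braket u (dagger A *v v)"
    by (simp add: braket_def matrix_vector_mult_def dagger_def sum_distrib_left mult_ac)
  finally show ?thesis .
qed

lemma braket_unitary: "unitary_op U \<Longrightarrow> braket (U *v u) (U *v v) = braket u v"
  by (simp add: braket_dagger matrix_vector_mul_assoc unitary_op_def)

lemma norm_unitary:
  assumes "unitary_op U" shows "norm (U *v u) = norm u"
proof -
  have "(norm (U *v u))\<^sup>2 = (norm u)\<^sup>2"
    using braket_unitary[OF assms, of u u] unfolding braket_self of_real_eq_iff .
  then show ?thesis by simp
qed

lemma unitary_op_mult: "unitary_op U \<Longrightarrow> unitary_op V \<Longrightarrow> unitary_op (U ** V)"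
  unfolding unitary_op_def dagger_mult
  by (metis matrix_mul_assoc matrix_mul_rid)

lemma dagger_dagger: "dagger (dagger A) = A"
  by (simp add: dagger_def vec_eq_iff)

lemma unitary_op_dagger: "unitary_op U \<Longrightarrow> unitary_op (dagger U)"
  by (simp add: unitary_op_def dagger_dagger)

lemma overlap_bound:
  assumes "0 \<le> a" "0 \<le> b" "unitary_op U"
    and n: "norm \<psi> = 1" "norm \<phi> = 1" "norm \<psi>' = 1" "norm \<phi>' = 1"
  shows "a * (2 * (cmod (braket \<psi>' (U *v \<psi>)))\<^sup>2 - 1) + b * (2 * (cmod (braket \<phi>' (U *v \<phi>)))\<^sup>2 - 1)
    \<le> cmod (of_real a + of_real b * cis (2 * (fubini_study \<psi> \<phi> - fubini_study \<psi>' \<phi>')))"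
    (is "_ \<le> cmod (_ + _ * cis (2 * ?e))")
proof -
  define s where "s = fubini_study \<psi>' (U *v \<psi>)"
  define t where "t = fubini_study \<phi>' (U *v \<phi>)"
  have nU: "norm (U *v \<psi>) = 1" "norm (U *v \<phi>) = 1" using assms by (simp_all add: norm_unitary)
  have U: "fubini_study (U *v \<psi>) (U *v \<phi>) = fubini_study \<psi> \<phi>"
    using assms by (simp add: fubini_study_def braket_unitary)
  \<comment> \<open>Two routes through the four points: from \<open>U \<psi>\<close> to
    \<open>U \<phi>\<close> via \<open>\<psi>'\<close> and \<open>\<phi>'\<close>, then from
    \<open>\<psi>'\<close> to \<open>\<phi>'\<close> via \<open>U \<psi>\<close> and
    \<open>U \<phi>\<close>. Together they bound the difference of angles in both
    directions.\<close>
  have "fubini_study \<psi> \<phi> \<le> fubini_study (U *v \<psi>) \<psi>' + (fubini_study \<psi>' \<phi>' + fubini_study \<phi>' (U *v \<phi>))"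
    using fubini_study_triangle[of "U *v \<psi>" \<psi>' "U *v \<phi>"] fubini_study_triangle[of \<psi>' \<phi>' "U *v \<phi>"] n nU U
    by linarith
  moreover have "fubini_study \<psi>' \<phi>' \<le> fubini_study \<psi>' (U *v \<psi>) + (fubini_study \<psi> \<phi> + fubini_study (U *v \<phi>) \<phi>')"
    using fubini_study_triangle[of \<psi>' "U *v \<psi>" \<phi>'] fubini_study_triangle[of "U *v \<psi>" "U *v \<phi>" \<phi>'] n nU U
    by linarith
  ultimately have st: "\<bar>?e\<bar> \<le> s + t"
    by (simp add: s_def t_def fubini_study_commute[of _ "U *v _"])
  have range: "0 \<le> s" "s \<le> pi / 2" "0 \<le> t" "t \<le> pi / 2"
    unfolding s_def t_def using n nU by (simp_all only: fubini_study_nonneg fubini_study_le)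
  have "\<bar>?e\<bar> \<le> pi / 2"
    using fubini_study_nonneg[of \<psi> \<phi>] fubini_study_le[of \<psi> \<phi>]
      fubini_study_nonneg[of \<psi>' \<phi>'] fubini_study_le[of \<psi>' \<phi>'] n by linarith
  have "a * cos (2 * s) + b * cos (2 * t) \<le> cmod (of_real a + of_real b * cis (2 * \<bar>?e\<bar>))"
    using cosine_combination_le[of a b "\<bar>?e\<bar>" s t] assms range st \<open>\<bar>?e\<bar> \<le> pi / 2\<close> by simp
  also have "\<dots> = cmod (of_real a + of_real b * cis (2 * ?e))"
    unfolding sqrt_law_of_cosines[symmetric] by simp
  finally show ?thesis
    unfolding s_def t_def using n nU by (simp add: cos_double_cos cos_fubini_study)
qed

section \<open>Channels and outcome probabilities\<close>

text \<open>The index set is a finite disjoint union of copies of \<open>UNIV\<close>, so the sum is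
  built one copy at a time. It evaluates the trace over ancilla times system.\<close>

lemma has_sum_product_finite:
  fixes f :: "'a \<Rightarrow> complex"
  assumes "(f has_sum s) UNIV" "finite A"
  shows "((\<lambda>(k, i). f k * h i) has_sum (s * sum h A)) (UNIV \<times> A)"
  using assms(2)
proof induction
  case empty
  then show ?case by simp
next
  case (insert x A)
  have "((\<lambda>k. f k * h x) has_sum (s * h x)) UNIV"
    by (rule has_sum_cmult_left) fact
  then have "((\<lambda>(k, i). f k * h i) has_sum (s * h x)) (range (\<lambda>k. (k, x)))"
    by (subst has_sum_reindex) (auto simp: inj_on_def o_def)
  then have "((\<lambda>(k, i). f k * h i) has_sum (s * h x + s * sum h A)) (range (\<lambda>k. (k, x)) \<union> UNIV \<times> A)"
    using insert by (intro has_sum_Un_disjoint) auto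
  also have "range (\<lambda>k. (k, x)) \<union> UNIV \<times> A = UNIV \<times> insert x A" by auto
  finally show ?case using insert by (simp add: algebra_simps)
qed

text \<open>Each conjugation is complex linear, and scaling is a bounded linear map, so it passes
  through the infinite mixture. This is what lets \<open>id_tensor\<close> act on a block of
  \<open>\<xi> \<otimes> \<rho>\<close>, which is a scalar multiple of
  \<open>\<rho>\<close>.\<close>

lemma random_unitary_channel_scale:
  assumes "random_unitary_channel \<Lambda>"
  shows "\<Lambda> (\<chi> i j. c * X $ i $ j) = (\<chi> i j. c * \<Lambda> X $ i $ j)"
proof -
  let ?h = "\<lambda>M :: complex^'a^'a. \<chi> i j. c * M $ i $ j"
  obtain p and U :: "nat \<Rightarrow> complex^'a^'a" where
    \<Lambda>: "\<And>\<rho>. ((\<lambda>x. p x *\<^sub>R (U x ** \<rho> ** dagger (U x))) has_sum \<Lambda> \<rho>) UNIV"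
    using assms unfolding random_unitary_channel_def by blast
  have "bounded_linear ?h"
    unfolding linear_conv_bounded_linear[symmetric]
    by (rule linearI) (simp_all add: vec_eq_iff algebra_simps)
  from has_sum_bounded_linear[OF this \<Lambda>]
  have "((\<lambda>x. ?h (p x *\<^sub>R (U x ** X ** dagger (U x)))) has_sum ?h (\<Lambda> X)) UNIV" .
  moreover have "?h (p x *\<^sub>R (U x ** X ** dagger (U x))) = p x *\<^sub>R (U x ** ?h X ** dagger (U x))" for x
    by (simp add: matrix_matrix_mult_def vec_eq_iff sum_distrib_left sum_distrib_right mult_ac
        scaleR_conv_of_real[where 'a=complex])
  ultimately have "((\<lambda>x. p x *\<^sub>R (U x ** ?h X ** dagger (U x))) has_sum ?h (\<Lambda> X)) UNIV"
    by (simp only:)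
  with \<Lambda>[of "?h X"] show ?thesis by (rule has_sum_unique)
qed

text \<open>The identity on the ancilla leaves only the diagonal entries of \<open>\<xi>\<close> in
  the trace, and these sum to 1.\<close>

lemma outcome_prob_eq:
  assumes "kernel_density \<xi>" "random_unitary_channel \<Lambda>"
  shows "outcome_prob \<xi> \<rho> E \<Lambda> = Re (trace (E ** \<Lambda> \<rho>))"
proof -
  let ?Y = "id_tensor \<Lambda> (tensor_op \<xi> \<rho>)"
  have diag: "kernel_mult (tensor_op kernel_id E) ?Y (k, i) (k, i) = \<xi> k k * (E ** \<Lambda> \<rho>) $ i $ i" for k i
  proof -
    \<comment> \<open>Terms with an ancilla index other than \<open>k\<close> vanish, so the
      infinite sum collapses to a finite one over the system index.\<close>
    have "kernel_mult (tensor_op kernel_id E) ?Y (k, i) (k, i)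
        = (\<Sum>\<^sub>\<infinity>y\<in>{k} \<times> UNIV. tensor_op kernel_id E (k, i) y * ?Y y (k, i))"
      unfolding kernel_mult_def
      by (rule infsum_cong_neutral) (auto simp: tensor_op_def kernel_id_def)
    also have "\<dots> = (\<Sum>y\<in>{k} \<times> UNIV. tensor_op kernel_id E (k, i) y * ?Y y (k, i))"
      by simp
    also have "\<dots> = (\<Sum>j\<in>UNIV. tensor_op kernel_id E (k, i) (k, j) * ?Y (k, j) (k, i))"
      by (rule sum.reindex_bij_witness[of _ "Pair k" snd]) auto
    also have "\<dots> = \<xi> k k * (E ** \<Lambda> \<rho>) $ i $ i"
      by (simp add: tensor_op_def kernel_id_def id_tensor_def matrix_matrix_mult_def
          random_unitary_channel_scale[OF assms(2)] sum_distrib_left mult_ac)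
    finally show ?thesis .
  qed
  have "((\<lambda>k. \<xi> k k) has_sum 1) UNIV" using assms(1) by (simp add: kernel_density_def)
  from has_sum_product_finite[OF this, of UNIV "\<lambda>i. (E ** \<Lambda> \<rho>) $ i $ i"]
  have "((\<lambda>(k, i). \<xi> k k * (E ** \<Lambda> \<rho>) $ i $ i) has_sum trace (E ** \<Lambda> \<rho>)) UNIV"
    by (simp add: trace_def)
  also have "(\<lambda>(k, i). \<xi> k k * (E ** \<Lambda> \<rho>) $ i $ i) = (\<lambda>x. kernel_mult (tensor_op kernel_id E) ?Y x x)"
    using diag by auto
  finally have "((\<lambda>x. kernel_mult (tensor_op kernel_id E) ?Y x x) has_sum trace (E ** \<Lambda> \<rho>)) UNIV" .
  then show ?thesis unfolding outcome_prob_def kernel_trace_def by (metis infsumI)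
qed

lemma matrix_add_rdistrib: "(A + B) ** C = A ** C + B ** C"
  by (simp add: matrix_matrix_mult_def vec_eq_iff distrib_right sum.distrib)

lemma scaleR_matrix_mult_left: "(c *\<^sub>R A) ** B = c *\<^sub>R (A ** B)" for A :: "complex^'n^'m"
  by (simp add: matrix_matrix_mult_def vec_eq_iff scaleR_sum_right)

lemma scaleR_matrix_mult_right: "A ** (c *\<^sub>R B) = c *\<^sub>R (A ** B)" for A :: "complex^'n^'m"
  by (simp add: matrix_matrix_mult_def vec_eq_iff scaleR_sum_right)

lemma trace_scaleR: "trace (c *\<^sub>R A) = of_real c * trace A" for A :: "complex^'n^'n"
  by (simp add: trace_def scaleR_conv_of_real[where 'a=complex] sum_distrib_left)

lemma bounded_linear_Re_trace_left: "bounded_linear (\<lambda>A. Re (trace (A ** X)))" for X :: "complex^'n^'n"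
  unfolding linear_conv_bounded_linear[symmetric]
  by (rule linearI)
    (simp_all add: matrix_add_rdistrib trace_add scaleR_matrix_mult_left trace_scaleR)

lemma bounded_linear_Re_trace_right: "bounded_linear (\<lambda>X. Re (trace (A ** X)))" for A :: "complex^'n^'n"
  unfolding linear_conv_bounded_linear[symmetric]
  by (rule linearI)
    (simp_all add: matrix_add_ldistrib trace_add scaleR_matrix_mult_right trace_scaleR)

text \<open>Summability passes to subsets in a complete space. Hence \<open>infsum E M\<close> is a
  genuine sum and not the default value of a divergent one.\<close>

lemma povm_has_sum_subset:
  fixes E :: "'m \<Rightarrow> complex^'n^'n"
  assumes "povm \<Omega> E" "M \<subseteq> \<Omega>"
  shows "(E has_sum infsum E M) M"
  using assms summable_on_subset_banach[of E \<Omega> M] unfolding povm_def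
  by (meson has_sum_imp_summable has_sum_infsum)

lemma infsum_outcome_prob:
  assumes "kernel_density \<xi>" "random_unitary_channel \<Lambda>" "povm \<Omega> E" "M \<subseteq> \<Omega>"
  shows "(\<Sum>\<^sub>\<infinity>m\<in>M. outcome_prob \<xi> \<rho> (E m) \<Lambda>) = Re (trace (infsum E M ** \<Lambda> \<rho>))"
  unfolding outcome_prob_eq[OF assms(1,2)]
  by (intro infsumI has_sum_bounded_linear[OF bounded_linear_Re_trace_left] povm_has_sum_subset[OF assms(3,4)])

text \<open>Polarization: the quadratic form is real at basis vector \<open>i\<close> plus
  \<open>c\<close> times basis vector \<open>j\<close>. Taking \<open>c = 1\<close> makes the
  imaginary parts of the two off-diagonal entries opposite; taking the imaginary unit makes their
  real parts equal.\<close>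

lemma positive_op_dagger:
  assumes "positive_op A" shows "dagger A = A"
proof -
  have "cnj (axis i 1 $ k) = (if k = i then 1 else 0)" for i k :: 'a
    by (simp add: axis_def)
  then have entry: "braket (axis i 1) (A *v axis j 1) = A $ i $ j" for i j
    by (simp add: braket_def mult_delta_left) (simp add: matrix_vector_mult_def axis_def mult_delta_right)
  have real: "Im (braket v (A *v v)) = 0" for v
    using assms unfolding positive_op_def complex_is_Real_iff by blast
  have "cnj (A $ i $ j) = A $ j $ i" for i j
  proof -
    have *: "Im (c * A $ i $ j + cnj c * A $ j $ i + A $ i $ i + cnj c * c * A $ j $ j) = 0" for c
    proof -
      have "braket (axis i 1 + c *s axis j 1) (A *v (axis i 1 + c *s axis j 1))
         = c * A $ i $ j + cnj c * A $ j $ i + A $ i $ i + cnj c * c * A $ j $ j"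
        unfolding matrix_vector_right_distrib vector_scalar_commute braket_add_right braket_add_left
          braket_scale_left braket_scale_right entry
        by (simp add: distrib_left mult_ac add_ac)
      then show ?thesis using real[of "axis i 1 + c *s axis j 1"] by (simp only:)
    qed
    have "Im (A $ i $ i) = 0" "Im (A $ j $ j) = 0"
      using real[of "axis i 1"] real[of "axis j 1"] unfolding entry by auto
    with *[of 1] *[of \<i>] show ?thesis by (simp add: complex_eq_iff)
  qed
  then show ?thesis by (simp add: dagger_def vec_eq_iff)
qed

lemma infsum_povm_dagger:
  fixes E :: "'m \<Rightarrow> complex^'n^'n"
  assumes "povm \<Omega> E" "M \<subseteq> \<Omega>"
  shows "dagger (infsum E M) = infsum E M"
proof -
  have "bounded_linear (dagger :: complex^'n^'n \<Rightarrow> _)"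
    unfolding linear_conv_bounded_linear[symmetric]
    by (rule linearI) (simp_all add: dagger_def vec_eq_iff)
  from has_sum_bounded_linear[OF this povm_has_sum_subset[OF assms]]
  have "((\<lambda>m. dagger (E m)) has_sum dagger (infsum E M)) M" .
  moreover have "dagger (E m) = E m" if "m \<in> M" for m
    using assms that by (auto simp: povm_def intro: positive_op_dagger)
  ultimately have "(E has_sum dagger (infsum E M)) M"
    by (simp cong: has_sum_cong)
  from infsumI[OF this] show ?thesis by (rule sym)
qed

lemma unitary_channel:
  assumes "unitary_op U"
  shows "random_unitary_channel (\<lambda>X. U ** X ** dagger U)"
  unfolding random_unitary_channel_def
proof (intro exI conjI allI)
  \<comment> \<open>A point mass at 0. The same \<open>U\<close> sits at every index, since indices
    of weight 0 must carry unitaries too.\<close>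
  let ?p = "\<lambda>x :: nat. if x = 0 then 1 else 0 :: real"
  show "(?p has_sum 1) UNIV"
    using has_sum_cong_neutral[of UNIV "{0}" ?p ?p 1] has_sum_finite[of "{0}" ?p] by auto
  show "((\<lambda>x. ?p x *\<^sub>R (U ** X ** dagger U)) has_sum (U ** X ** dagger U)) UNIV" for X
    using has_sum_cong_neutral[of UNIV "{0}" "\<lambda>x. ?p x *\<^sub>R (U ** X ** dagger U)" "\<lambda>x. ?p x *\<^sub>R (U ** X ** dagger U)"]
      has_sum_finite[of "{0}" "\<lambda>x. ?p x *\<^sub>R (U ** X ** dagger U)"] by auto
qed (use assms in auto)

text \<open>The left side is linear in the channel, so its value at a mixture is the weighted
  average of the values at the unitaries, with weights summing to 1.\<close>

lemma random_unitary_channel_le: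
  assumes "random_unitary_channel \<Lambda>"
    and "\<And>U. unitary_op U \<Longrightarrow> r * Re (trace (A ** (U ** \<rho> ** dagger U)))
      + r' * Re (trace (B ** (U ** \<tau> ** dagger U))) \<le> K"
  shows "r * Re (trace (A ** \<Lambda> \<rho>)) + r' * Re (trace (B ** \<Lambda> \<tau>)) \<le> K"
proof -
  obtain p U where p: "\<And>x. 0 \<le> p x" "(p has_sum 1) UNIV" and U: "\<And>x :: nat. unitary_op (U x)"
    and \<Lambda>: "\<And>\<rho>. ((\<lambda>x. p x *\<^sub>R (U x ** \<rho> ** dagger (U x))) has_sum \<Lambda> \<rho>) UNIV"
    using assms(1) unfolding random_unitary_channel_def by blast
  let ?f = "\<lambda>X Y. r * Re (trace (A ** X)) + r' * Re (trace (B ** Y))"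
  have 1: "((\<lambda>x. ?f (p x *\<^sub>R (U x ** \<rho> ** dagger (U x))) (p x *\<^sub>R (U x ** \<tau> ** dagger (U x))))
      has_sum ?f (\<Lambda> \<rho>) (\<Lambda> \<tau>)) UNIV"
    by (intro has_sum_add has_sum_cmult_right has_sum_bounded_linear[OF bounded_linear_Re_trace_right \<Lambda>])
  have 2: "((\<lambda>x. p x * K) has_sum (1 * K)) UNIV" by (intro has_sum_cmult_left p)
  have "?f (p x *\<^sub>R (U x ** \<rho> ** dagger (U x))) (p x *\<^sub>R (U x ** \<tau> ** dagger (U x))) \<le> p x * K" for x
    using mult_left_mono[OF assms(2)[OF U] p(1), of x]
    by (simp add: scaleR_matrix_mult_right trace_scaleR algebra_simps)
  from has_sum_mono[OF 1 2 this] show ?thesis by simp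
qed

section \<open>Qubit operators\<close>

definition ket_bra :: "complex^'n \<Rightarrow> complex^'n^'n" where
  "ket_bra v = (\<chi> i j. v $ i * cnj (v $ j))"

lemma ket_bra_mult_vec: "ket_bra v *v w = braket v w *s v"
  by (simp add: ket_bra_def braket_def matrix_vector_mult_def vec_eq_iff sum_distrib_left mult_ac)

lemma trace_ket_bra: "trace (ket_bra v) = of_real ((norm v)\<^sup>2)"
  unfolding braket_self[symmetric] by (simp add: trace_def ket_bra_def braket_def mult.commute)

lemma ket_bra_conj: "U ** ket_bra v ** dagger U = ket_bra (U *v v)"
proof -
  have "(\<Sum>k\<in>UNIV. (\<Sum>l\<in>UNIV. U $ i $ l * (v $ l * cnj (v $ k))) * cnj (U $ j $ k))
      = (\<Sum>l\<in>UNIV. U $ i $ l * v $ l) * (\<Sum>k\<in>UNIV. cnj (U $ j $ k) * cnj (v $ k))" for i j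
    by (subst sum_product) (subst sum.swap, simp add: sum_distrib_left mult_ac)
  then show ?thesis
    by (simp add: ket_bra_def matrix_matrix_mult_def matrix_vector_mult_def dagger_def vec_eq_iff)
qed

lemma trace_ket_bra_mult: "trace (ket_bra u ** ket_bra v) = of_real ((cmod (braket u v))\<^sup>2)"
proof -
  have "trace (ket_bra u ** ket_bra v) = (\<Sum>i\<in>UNIV. \<Sum>k\<in>UNIV. u $ i * cnj (u $ k) * (v $ k * cnj (v $ i)))"
    by (simp add: trace_def ket_bra_def matrix_matrix_mult_def)
  also have "\<dots> = braket v u * braket u v"
    by (simp add: braket_def sum_product mult_ac)
  finally show ?thesis by (simp add: complex_norm_square cnj_braket mult.commute del: of_real_power)
qed

text \<open>The spin flip of a qubit vector: it spans the orthogonal complement of a nonzero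
  \<open>v\<close> without any choice or normalization.\<close>

definition perp :: "complex^2 \<Rightarrow> complex^2" where
  "perp v = vector [- cnj (v $ 2), cnj (v $ 1)]"

lemma norm_perp: "norm (perp v) = norm v"
proof -
  have "braket (perp v) (perp v) = braket v v"
    by (simp add: braket_def perp_def sum_2 vector_2 mult.commute)
  then have "(norm (perp v))\<^sup>2 = (norm v)\<^sup>2" unfolding braket_self of_real_eq_iff .
  then show ?thesis by simp
qed

lemma braket_perp: "braket v (perp v) = 0"
  by (simp add: braket_def perp_def sum_2 vector_2 mult.commute)

text \<open>Pairing the eigenvalue equation with \<open>v\<close> gives \<open>c + d\<close> unless
  the eigenvector is orthogonal to \<open>v\<close>, and then the operator acts on it as
  \<open>c\<close>. The sign of \<open>d\<close> is left free because it is not yet known when the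
  lemma is applied.\<close>

lemma eigenvalues_ket_bra:
  fixes v :: "complex^2"
  assumes "norm v = 1"
  shows "eigenvalues (c *\<^sub>R mat 1 + d *\<^sub>R ket_bra v) = {c, c + d}"
proof -
  let ?A = "c *\<^sub>R mat 1 + d *\<^sub>R ket_bra v"
  have A: "?A *v w = of_real c *s w + (of_real d * braket v w) *s v" for w
  proof -
    have "?A *v w = c *\<^sub>R (mat 1 *v w) + d *\<^sub>R (ket_bra v *v w)"
      by (simp add: matrix_vector_mult_def vec_eq_iff forall_2 sum_2 scaleR_conv_of_real[where 'a=complex] algebra_simps)
    then show ?thesis
      by (simp add: ket_bra_mult_vec vec_eq_iff scaleR_conv_of_real[where 'a=complex])
  qed
  have vv: "braket v v = 1" using assms by (simp add: braket_self)
  have "x = c \<or> x = c + d" if "eigenpair ?A (of_real x) w" for x w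
  proof -
    have w: "w \<noteq> 0" and eq: "of_real c *s w + (of_real d * braket v w) *s v = of_real x *s w"
      using that by (auto simp: eigenpair_def A)
    show ?thesis
    proof (cases "braket v w = 0")
      case True
      then have "(of_real c :: complex) *s w = of_real x *s w" using eq by simp
      then show ?thesis using w by (auto simp: vec_eq_iff)
    next
      case False
      have "braket v (of_real c *s w + (of_real d * braket v w) *s v) = braket v (of_real x *s w)"
        using eq by simp
      then have "(of_real (c + d) :: complex) * braket v w = of_real x * braket v w"
        by (simp add: braket_add_right braket_scale_right vv algebra_simps)
      then show ?thesis using False by (metis mult_cancel_right of_real_eq_iff)
    qed
  qed
  moreover have "eigenpair ?A (of_real c) (perp v)"
    using assms norm_perp[of v] by (auto simp: eigenpair_def A braket_perp)
  moreover have "eigenpair ?A (of_real (c + d)) v"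
  proof -
    have "v \<noteq> 0" using assms by auto
    then show ?thesis unfolding eigenpair_def A vv by (simp add: vec_eq_iff distrib_right)
  qed
  ultimately show ?thesis unfolding eigenvalues_def by blast
qed

text \<open>In dimension 2 one eigenvector fixes the other eigenline, and the trace fixes the other
  eigenvalue. The coefficients use only trace and spread, the quantities in the final
  formula.\<close>

lemma spectral_decomposition:
  fixes A :: "complex^2^2"
  assumes herm: "dagger A = A" and top: "unit_top_eigenvector A v"
  shows "A = ((Re (trace A) - spread A) / 2) *\<^sub>R mat 1 + spread A *\<^sub>R ket_bra v"
    and "0 \<le> spread A"
proof -
  define x where "x = Max (eigenvalues A)"
  \<comment> \<open>The eigenvalues add up to the trace, so \<open>g\<close> is the other eigenvalue
    minus \<open>x\<close>; it turns out to be minus the spread.\<close>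
  define g where "g = Re (trace A) - 2 * x"
  have v: "norm v = 1" and Av: "A *v v = of_real x *s v"
    using top by (simp_all add: unit_top_eigenvector_def eigenpair_def x_def)
  have h: "cnj (A $ i $ j) = A $ j $ i" for i j
    using herm by (simp add: dagger_def vec_eq_iff)
  have tr: "of_real (Re (trace A)) = A $ 1 $ 1 + A $ 2 $ 2"
    using h[of 1 1] h[of 2 2] by (simp add: trace_def sum_2 complex_eq_iff)
  have n: "v $ 1 * cnj (v $ 1) + v $ 2 * cnj (v $ 2) = 1"
    using braket_self[of v] v by (simp add: braket_def sum_2 mult.commute)
  have e: "A $ 1 $ 1 * v $ 1 + A $ 1 $ 2 * v $ 2 = of_real x * v $ 1"
    "A $ 2 $ 1 * v $ 1 + A $ 2 $ 2 * v $ 2 = of_real x * v $ 2"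
    using Av by (simp_all add: matrix_vector_mult_def vec_eq_iff forall_2 sum_2)
  \<comment> \<open>Conjugating the row equations and using hermiticity gives equations for the
    columns.\<close>
  have e': "A $ 1 $ 1 * cnj (v $ 1) + A $ 2 $ 1 * cnj (v $ 2) = of_real x * cnj (v $ 1)"
    "A $ 1 $ 2 * cnj (v $ 1) + A $ 2 $ 2 * cnj (v $ 2) = of_real x * cnj (v $ 2)"
    using e[THEN arg_cong, of cnj] by (simp_all add: h)
  have g: "of_real g = A $ 1 $ 1 + A $ 2 $ 2 - 2 * of_real x" by (simp add: g_def tr)
  \<comment> \<open>The entries of \<open>x I + g (I - |v><v|)\<close>. They follow by polynomial
    elimination, without dividing by components of \<open>v\<close>, which may vanish.\<close>
  have entries: "A $ 1 $ 1 = of_real x + of_real g * (1 - v $ 1 * cnj (v $ 1))"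
    "A $ 2 $ 2 = of_real x + of_real g * (1 - v $ 2 * cnj (v $ 2))"
    "A $ 1 $ 2 = - of_real g * (v $ 1 * cnj (v $ 2))"
    "A $ 2 $ 1 = - of_real g * (v $ 2 * cnj (v $ 1))"
    unfolding g using n e e' by algebra+
  have A: "A = (x + g) *\<^sub>R mat 1 + (- g) *\<^sub>R ket_bra v"
    using entries by (simp add: vec_eq_iff forall_2 mat_def ket_bra_def scaleR_conv_of_real[where 'a=complex] algebra_simps)
  have ev: "eigenvalues A = {x + g, x}"
    using eigenvalues_ket_bra[OF v, of "x + g" "- g", folded A] by simp
  \<comment> \<open>Only now is the set of eigenvalues known to be finite, so that
    \<open>Max\<close> is a true maximum and decides the sign of \<open>g\<close>.\<close>
  have "x + g \<le> Max (eigenvalues A)" by (rule Max_ge) (simp_all add: ev)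
  then have "g \<le> 0" using x_def by linarith
  then have s: "spread A = - g" unfolding spread_def ev by simp
  then show "0 \<le> spread A" using \<open>g \<le> 0\<close> by simp
  have "(Re (trace A) - spread A) / 2 = x + g" by (simp add: s g_def)
  then show "A = ((Re (trace A) - spread A) / 2) *\<^sub>R mat 1 + spread A *\<^sub>R ket_bra v"
    using A s by simp
qed

text \<open>Conjugation fixes the scalar part of \<open>\<rho>\<close> and moves only its rank-one
  part, so \<open>U\<close> enters through a single overlap. The last factor is the cosine of twice
  the Fubini-Study angle.\<close>

lemma trace_unitary_conj:
  fixes A \<rho> U :: "complex^2^2"
  assumes "dagger A = A" "unit_top_eigenvector A v" "density_op \<rho>" "unit_top_eigenvector \<rho> u" "unitary_op U"
  shows "Re (trace (A ** (U ** \<rho> ** dagger U)))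
    = Re (trace A) / 2 + spread \<rho> * spread A / 2 * (2 * (cmod (braket v (U *v u)))\<^sup>2 - 1)"
proof -
  define \<alpha> s \<beta> t where "\<alpha> = (Re (trace A) - spread A) / 2" and "s = spread A"
    and "\<beta> = (Re (trace \<rho>) - spread \<rho>) / 2" and "t = spread \<rho>"
  have n: "norm v = 1" "norm (U *v u) = 1"
    using assms by (auto simp: unit_top_eigenvector_def norm_unitary)
  have "dagger \<rho> = \<rho>" and tr: "trace \<rho> = 1"
    using assms by (auto simp: density_op_def positive_op_dagger)
  then have \<rho>: "\<rho> = \<beta> *\<^sub>R mat 1 + t *\<^sub>R ket_bra u"
    unfolding \<beta>_def t_def using spectral_decomposition(1) assms(4) by blast
  have A: "A = \<alpha> *\<^sub>R mat 1 + s *\<^sub>R ket_bra v"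
    unfolding \<alpha>_def s_def using spectral_decomposition(1) assms by blast
  have "U ** \<rho> ** dagger U = \<beta> *\<^sub>R mat 1 + t *\<^sub>R ket_bra (U *v u)"
    using assms(5) unfolding \<rho>
    by (simp add: matrix_add_ldistrib matrix_add_rdistrib scaleR_matrix_mult_left
        scaleR_matrix_mult_right ket_bra_conj unitary_op_def)
  then have "Re (trace (A ** (U ** \<rho> ** dagger U)))
      = 2 * \<alpha> * \<beta> + \<alpha> * t + s * \<beta> + s * t * (cmod (braket v (U *v u)))\<^sup>2"
    unfolding A using n
    by (simp add: matrix_add_ldistrib matrix_add_rdistrib scaleR_matrix_mult_left
        scaleR_matrix_mult_right trace_add trace_scaleR trace_ket_bra trace_ket_bra_mult trace_I
        algebra_simps del: of_real_power)
  \<comment> \<open>As \<open>\<rho>\<close> has trace 1, \<open>2 * \<beta> + t = 1\<close>, and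
    the sum reduces to \<open>\<alpha> + s * \<beta>\<close>.\<close>
  also have "2 * \<alpha> * \<beta> + \<alpha> * t + s * \<beta> = Re (trace A) / 2 - s * t / 2"
    by (simp add: \<alpha>_def \<beta>_def s_def t_def tr field_simps)
  finally show ?thesis by (simp add: s_def t_def algebra_simps)
qed

section \<open>The real plane and the optimal unitary\<close>

definition real_ket :: "real \<Rightarrow> complex^2" where
  "real_ket s = vector [of_real (cos s), of_real (sin s)]"

definition rotation :: "real \<Rightarrow> complex^2^2" where
  "rotation t = vector [vector [of_real (cos t), - of_real (sin t)], vector [of_real (sin t), of_real (cos t)]]"

lemma rotation_real_ket: "rotation t *v real_ket s = real_ket (t + s)"
  by (simp add: rotation_def real_ket_def vec_eq_iff forall_2 matrix_vector_mult_def sum_2 cos_add sin_add)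

lemma braket_real_ket: "braket (real_ket s) (real_ket t) = of_real (cos (t - s))"
  by (simp add: braket_def real_ket_def sum_2 cos_diff algebra_simps)

lemma unitary_opI: "dagger U ** U = mat 1 \<Longrightarrow> unitary_op U"
  by (simp add: unitary_op_def matrix_left_right_inverse)

lemma unitary_op_rotation: "unitary_op (rotation t)"
proof (rule unitary_opI)
  have "(of_real (cos t))\<^sup>2 + (of_real (sin t))\<^sup>2 = (1 :: complex)"
    by (simp flip: of_real_power of_real_add)
  then show "dagger (rotation t) ** rotation t = mat 1"
    by (simp add: rotation_def dagger_def vec_eq_iff forall_2 matrix_matrix_mult_def sum_2 mat_def
        power2_eq_square algebra_simps)
qed

text \<open>Any two unit vectors are, up to a phase on the second, the unitary image of two real
  vectors at the same angle. Two phases achieve this: \<open>w\<close> makes the overlap with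
  \<open>\<psi>\<close> real, and \<open>h\<close> then makes the component along
  \<open>perp \<psi>\<close> real.\<close>

lemma adapted_unitary:
  fixes \<psi> \<phi> :: "complex^2"
  assumes n: "norm \<psi> = 1" "norm \<phi> = 1"
  obtains V w where "unitary_op V" "cmod w = 1" "V *v real_ket 0 = \<psi>"
    "V *v real_ket (fubini_study \<psi> \<phi>) = w *s \<phi>"
proof -
  have nn: "v $ 1 * cnj (v $ 1) + v $ 2 * cnj (v $ 2) = 1" if "norm v = 1" for v :: "complex^2"
    using braket_self[of v] that by (simp add: braket_def sum_2 mult.commute)
  let ?z = "braket (perp \<psi>) \<phi>"
  have exp: "\<phi> = braket \<psi> \<phi> *s \<psi> + ?z *s perp \<psi>"
    using nn[OF n(1)] by (simp add: vec_eq_iff forall_2 braket_def perp_def sum_2) algebra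
  have "\<phi> - braket \<psi> \<phi> *s \<psi> = ?z *s perp \<psi>" by (subst (1) exp) simp
  then have z: "cmod ?z = sin (fubini_study \<psi> \<phi>)"
    using norm_orthogonal_part[OF n(2,1)] n by (simp add: norm_scale_vec norm_perp sin_fubini_study)
  obtain w where w: "cmod w = 1" "w * braket \<psi> \<phi> = of_real (cos (fubini_study \<psi> \<phi>))"
    using phase_exists cos_fubini_study[OF n] by metis
  obtain h where h: "cmod h = 1" "h * (w * ?z) = of_real (sin (fubini_study \<psi> \<phi>))"
    using phase_exists[of "w * ?z"] z w by (auto simp: norm_mult)
  have hh: "cnj h * h = 1" using h(1) by (metis complex_norm_square mult.commute of_real_1 one_power2)
  \<comment> \<open>The columns are \<open>\<psi>\<close> and \<open>perp \<psi>\<close>, the latter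
    with the inverse of \<open>h\<close>, so that the real coefficient of the sine gives back the
    complex component of \<open>w *s \<phi>\<close>.\<close>
  define V :: "complex^2^2" where
    "V = (\<chi> i j. if j = 1 then \<psi> $ i else cnj h * perp \<psi> $ i)"
  have V: "V *v real_ket s = of_real (cos s) *s \<psi> + (of_real (sin s) * cnj h) *s perp \<psi>" for s
    by (simp add: V_def real_ket_def matrix_vector_mult_def sum_2 vec_eq_iff mult_ac)
  show thesis
  proof
    show "unitary_op V"
    proof (rule unitary_opI)
      show "dagger V ** V = mat 1"
        using nn[OF n(1)] hh
        by (simp add: V_def perp_def dagger_def vec_eq_iff forall_2 matrix_matrix_mult_def sum_2 mat_def) algebra
    qed
    show "V *v real_ket 0 = \<psi>" by (simp add: V)
    have "V *v real_ket (fubini_study \<psi> \<phi>) = (w * braket \<psi> \<phi>) *s \<psi> + (w * ?z * (cnj h * h)) *s perp \<psi>"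
      unfolding V w(2)[symmetric] h(2)[symmetric] by (simp add: mult_ac)
    also have "\<dots> = w *s (braket \<psi> \<phi> *s \<psi> + ?z *s perp \<psi>)"
      unfolding hh by (simp add: vec_eq_iff algebra_simps)
    finally show "V *v real_ket (fubini_study \<psi> \<phi>) = w *s \<phi>" by (simp flip: exp)
  qed (fact w)
qed

lemma overlap_bound_attained:
  fixes \<psi> \<phi> \<psi>' \<phi>' :: "complex^2"
  assumes n: "norm \<psi> = 1" "norm \<phi> = 1" "norm \<psi>' = 1" "norm \<phi>' = 1"
  obtains U where "unitary_op U"
    "a * (2 * (cmod (braket \<psi>' (U *v \<psi>)))\<^sup>2 - 1) + b * (2 * (cmod (braket \<phi>' (U *v \<phi>)))\<^sup>2 - 1)
      = cmod (of_real a + of_real b * cis (2 * (fubini_study \<psi> \<phi> - fubini_study \<psi>' \<phi>')))"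
proof -
  define \<alpha> \<beta> where "\<alpha> = fubini_study \<psi> \<phi>" and "\<beta> = fubini_study \<psi>' \<phi>'"
  obtain V v where V: "unitary_op V" "cmod v = 1" "V *v real_ket 0 = \<psi>" "V *v real_ket \<alpha> = v *s \<phi>"
    unfolding \<alpha>_def using adapted_unitary n by metis
  obtain W w where W: "unitary_op W" "cmod w = 1" "W *v real_ket 0 = \<psi>'" "W *v real_ket \<beta> = w *s \<phi>'"
    unfolding \<beta>_def using adapted_unitary n by metis
  let ?z = "of_real a + of_real b * cis (2 * (\<alpha> - \<beta>))"
  \<comment> \<open>Chosen so that \<open>cis (2 * t)\<close> turns \<open>?z\<close> onto the
    nonnegative real axis. Then \<open>cmod ?z\<close> is the real part of the turned vector, a
    combination of two cosines.\<close>
  define t where "t = - Arg ?z / 2"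
  \<comment> \<open>From the frame of \<open>\<psi>\<close>, \<open>\<phi>\<close> to the real
    plane, a rotation by \<open>t\<close> there, then on to the frame of \<open>\<psi>'\<close>,
    \<open>\<phi>'\<close>. The overlaps become cosines of \<open>t\<close> and
    \<open>t + \<alpha> - \<beta>\<close>, while the phases \<open>v\<close> and \<open>w\<close>
    leave the moduli unchanged.\<close>
  define U where "U = W ** rotation t ** dagger V"
  have "unitary_op U"
    unfolding U_def by (intro unitary_op_mult unitary_op_dagger unitary_op_rotation V W)
  have U: "U *v (V *v x) = W *v (rotation t *v x)" for x
    using V(1) by (simp add: U_def matrix_vector_mul_assoc unitary_op_def matrix_mul_assoc[symmetric])
  have 1: "cmod (braket \<psi>' (U *v \<psi>)) = \<bar>cos t\<bar>"
    unfolding V(3)[symmetric] W(3)[symmetric] U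
    by (simp add: rotation_real_ket braket_unitary W(1) braket_real_ket)
  have "cmod (braket \<phi>' (U *v \<phi>)) = cmod (braket (w *s \<phi>') (U *v (v *s \<phi>)))"
    using V(2) W(2) by (simp add: vector_scalar_commute braket_scale_left braket_scale_right norm_mult)
  also have "\<dots> = \<bar>cos (t + \<alpha> - \<beta>)\<bar>"
    unfolding V(4)[symmetric] W(4)[symmetric] U
    by (simp add: rotation_real_ket braket_unitary W(1) braket_real_ket)
  finally have 2: "cmod (braket \<phi>' (U *v \<phi>)) = \<bar>cos (t + \<alpha> - \<beta>)\<bar>" .
  have "cis (2 * t) * ?z = cis (2 * t) * (of_real (cmod ?z) * cis (Arg ?z))"
    using rcis_cmod_Arg[of ?z] by (simp only: rcis_def)
  also have "\<dots> = of_real (cmod ?z)"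
    by (simp add: t_def cis_mult mult.left_commute)
  finally have "cmod ?z = Re (cis (2 * t) * ?z)" by (metis Re_complex_of_real)
  also have "cis (2 * t) * ?z = of_real a * cis (2 * t) + of_real b * cis (2 * (t + \<alpha> - \<beta>))"
    by (simp add: cis_mult algebra_simps)
  also have "Re \<dots> = a * cos (2 * t) + b * cos (2 * (t + \<alpha> - \<beta>))" by simp
  finally have "cmod ?z = a * (2 * (cos t)\<^sup>2 - 1) + b * (2 * (cos (t + \<alpha> - \<beta>))\<^sup>2 - 1)"
    unfolding cos_double_cos .
  then show thesis
    by (intro that[OF \<open>unitary_op U\<close>]) (simp only: 1 2 power2_abs \<alpha>_def[symmetric] \<beta>_def[symmetric])
qed

section \<open>The maximum over all random unitary channels\<close>

theorem theorem1:
  fixes r :: real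
    and \<xi> :: "('k, complex) kernel" and \<xi>' :: "('l, complex) kernel"
    and \<rho> \<tau> :: "complex^2^2"
    and \<Omega>E \<M> :: "'m set" and \<Omega>F \<N> :: "'n set"
    and E :: "'m \<Rightarrow> complex^2^2" and F :: "'n \<Rightarrow> complex^2^2"
    and \<psi> \<phi> \<psi>' \<phi>' :: "complex^2"
    and EM FN :: "complex^2^2"
    and S :: "(complex^2^2 \<Rightarrow> complex^2^2) \<Rightarrow> real"
    and C Z a b :: real
  defines "EM \<equiv> (\<Sum>\<^sub>\<infinity>m\<in>\<M>. E m)"
    and "FN \<equiv> (\<Sum>\<^sub>\<infinity>n\<in>\<N>. F n)"
    and "S \<equiv> (\<lambda>\<Lambda>. r * (\<Sum>\<^sub>\<infinity>m\<in>\<M>. outcome_prob \<xi> \<rho> (E m) \<Lambda>)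
                   + (1 - r) * (\<Sum>\<^sub>\<infinity>n\<in>\<N>. outcome_prob \<xi>' \<tau> (F n) \<Lambda>))"
    and "C \<equiv> (GREATEST c. \<exists>\<Lambda>. random_unitary_channel \<Lambda> \<and> c = S \<Lambda>)"
    and "Z \<equiv> Re (trace (r *\<^sub>R EM + (1 - r) *\<^sub>R FN))"
    and "a \<equiv> r * spread \<rho> * spread EM"
    and "b \<equiv> (1 - r) * spread \<tau> * spread FN"
  assumes "0 \<le> r" and "r \<le> 1"
    and "kernel_density \<xi>" and "density_op \<rho>" and "povm \<Omega>E E"
    and "kernel_density \<xi>'" and "density_op \<tau>" and "povm \<Omega>F F"
    and "\<M> \<subseteq> \<Omega>E" and "\<N> \<subseteq> \<Omega>F"
    and "unit_top_eigenvector \<rho> \<psi>" and "unit_top_eigenvector \<tau> \<phi>"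
    and "unit_top_eigenvector EM \<psi>'" and "unit_top_eigenvector FN \<phi>'"
  shows "(\<exists>\<Lambda>. random_unitary_channel \<Lambda> \<and> S \<Lambda> = C)
    \<and> (\<forall>\<Lambda>. random_unitary_channel \<Lambda> \<longrightarrow> S \<Lambda> \<le> C)
    \<and> C = Z / 2 + 1 / 2 * sqrt ((a - b)\<^sup>2 + 4 * a * b *
          (cmod (braket \<psi> \<phi>) * cmod (braket \<psi>' \<phi>')
           + sqrt ((1 - (cmod (braket \<psi> \<phi>))\<^sup>2) * (1 - (cmod (braket \<psi>' \<phi>'))\<^sup>2)))\<^sup>2)"
proof -
  define \<alpha> \<beta> where "\<alpha> = fubini_study \<psi> \<phi>" and "\<beta> = fubini_study \<psi>' \<phi>'"
  \<comment> \<open>The claimed maximum in planar-vector form, which both the bound and the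
    attaining unitary produce.\<close>
  define K where "K = Z / 2 + 1 / 2 * cmod (of_real a + of_real b * cis (2 * (\<alpha> - \<beta>)))"
  have n: "norm \<psi> = 1" "norm \<phi> = 1" "norm \<psi>' = 1" "norm \<phi>' = 1"
    using assms(18-21) by (simp_all add: unit_top_eigenvector_def)
  have herm: "dagger EM = EM" "dagger FN = FN" "dagger \<rho> = \<rho>" "dagger \<tau> = \<tau>"
    using assms infsum_povm_dagger[of \<Omega>E E \<M>] infsum_povm_dagger[of \<Omega>F F \<N>]
    by (simp_all add: EM_def FN_def density_op_def positive_op_dagger)
  have ab: "0 \<le> a" "0 \<le> b"
    unfolding a_def b_def using assms herm
    by (auto intro!: mult_nonneg_nonneg spectral_decomposition(2))
  have S: "S \<Lambda> = r * Re (trace (EM ** \<Lambda> \<rho>)) + (1 - r) * Re (trace (FN ** \<Lambda> \<tau>))"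
    if "random_unitary_channel \<Lambda>" for \<Lambda>
    unfolding S_def EM_def FN_def using assms that by (simp add: infsum_outcome_prob)
  have unitary: "r * Re (trace (EM ** (U ** \<rho> ** dagger U))) + (1 - r) * Re (trace (FN ** (U ** \<tau> ** dagger U)))
      = Z / 2 + 1 / 2 * (a * (2 * (cmod (braket \<psi>' (U *v \<psi>)))\<^sup>2 - 1)
          + b * (2 * (cmod (braket \<phi>' (U *v \<phi>)))\<^sup>2 - 1))" if "unitary_op U" for U
  proof -
    have "Z = r * Re (trace EM) + (1 - r) * Re (trace FN)"
      by (simp add: Z_def trace_add trace_scaleR)
    then show ?thesis
      unfolding trace_unitary_conj[OF herm(1) assms(20) assms(11) assms(18) that]
        trace_unitary_conj[OF herm(2) assms(21) assms(14) assms(19) that]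
      by (simp add: a_def b_def field_simps)
  qed
  have le: "S \<Lambda> \<le> K" if "random_unitary_channel \<Lambda>" for \<Lambda>
    unfolding S[OF that]
  proof (rule random_unitary_channel_le[OF that])
    fix U :: "complex^2^2"
    assume U: "unitary_op U"
    from overlap_bound[OF ab U n]
    show "r * Re (trace (EM ** (U ** \<rho> ** dagger U))) + (1 - r) * Re (trace (FN ** (U ** \<tau> ** dagger U))) \<le> K"
      unfolding unitary[OF U] K_def \<alpha>_def \<beta>_def
      by (intro add_left_mono mult_left_mono) simp_all
  qed
  obtain U where U: "unitary_op U"
    "a * (2 * (cmod (braket \<psi>' (U *v \<psi>)))\<^sup>2 - 1) + b * (2 * (cmod (braket \<phi>' (U *v \<phi>)))\<^sup>2 - 1)
      = cmod (of_real a + of_real b * cis (2 * (\<alpha> - \<beta>)))"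
    unfolding \<alpha>_def \<beta>_def using overlap_bound_attained[OF n] by metis
  have attained: "random_unitary_channel (\<lambda>X. U ** X ** dagger U)" "S (\<lambda>X. U ** X ** dagger U) = K"
    using unitary_channel[OF U(1)] unitary[OF U(1)] U(2) by (simp_all add: S K_def)
  \<comment> \<open>\<open>GREATEST\<close> denotes the maximum once a greatest element exists:
    \<open>attained\<close> makes \<open>K\<close> a value and \<open>le\<close> makes it an upper
    bound.\<close>
  have C: "C = K"
    unfolding C_def by (rule Greatest_equality) (use le attained in metis, use le in blast)
  \<comment> \<open>The bracket in the claimed formula is the subtraction formula for the cosine of
    the two Fubini-Study angles.\<close>
  have "cos (\<alpha> - \<beta>) = cmod (braket \<psi> \<phi>) * cmod (braket \<psi>' \<phi>')
      + sqrt ((1 - (cmod (braket \<psi> \<phi>))\<^sup>2) * (1 - (cmod (braket \<psi>' \<phi>'))\<^sup>2))"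
    unfolding \<alpha>_def \<beta>_def using n
    by (simp add: cos_diff cos_fubini_study sin_fubini_study real_sqrt_mult)
  then have "K = Z / 2 + 1 / 2 * sqrt ((a - b)\<^sup>2 + 4 * a * b *
      (cmod (braket \<psi> \<phi>) * cmod (braket \<psi>' \<phi>')
       + sqrt ((1 - (cmod (braket \<psi> \<phi>))\<^sup>2) * (1 - (cmod (braket \<psi>' \<phi>'))\<^sup>2)))\<^sup>2)"
    unfolding K_def sqrt_law_of_cosines[symmetric] by (simp only:)
  then show ?thesis using C le attained by blast
qed

end
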